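(* If $q$ is a positive integer and $N = \dfrac{4^q-1}{3}$, then the Collatz sequence starting with $N$ reaches $1$ in $2q$ steps, i.e. $T^{2q}(N)=1$.
   Context: The Collatz map $T$ on positive integers is $T(n)=n/2$ if $n$ is even and $T(n)=(3n+1)/2$ if $n$ is odd. The Collatz sequence starting with $N$ is $N, T(N), T^2(N),\dots$, continued indefinitely. One step is one application of $T$; $N$ reaches a value $m$ in $s$ steps if $T^s(N)=m$ (this is not required to be the first occurrence of $m$). *)

theory Defs
  imports Main
begin

text \<open>The Collatz map, given on all of \<^typ>\<open>nat\<close>; only its values on positive arguments
  matter (it maps positive numbers to positive numbers, and \<open>0\<close> to \<open>0\<close>). Both divisions are exact.\<close>

definition collatz_T :: "nat \<Rightarrow> nat" where
  "collatz_T n = (if even n then n div 2 else (3 * n + 1) div 2)"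

definition reaches_in :: "nat \<Rightarrow> nat \<Rightarrow> nat \<Rightarrow> bool" where
  "reaches_in N m s \<longleftrightarrow> (collatz_T ^^ s) N = m"

text \<open>The natural-number quotient \<open>(4 ^ q - 1) div 3\<close> is exact, and the subtraction does not truncate.\<close>

lemma four_power_quotient_exact: "3 * ((4 ^ q - 1) div 3) + 1 = (4 ^ q :: nat)"
proof (induction q)
  case (Suc q)
  define k where "k = (4 ^ q - 1) div (3 :: nat)"
  have "(4 :: nat) ^ Suc q - 1 = 3 * (4 * k + 1)"
    using Suc by (simp add: k_def)
  then have "((4 :: nat) ^ Suc q - 1) div 3 = 4 * k + 1"
    by (metis nonzero_mult_div_cancel_left zero_neq_numeral)
  then show ?case
    using Suc unfolding k_def by simp
qed simp

end

theory Submission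
  imports Defs
begin

text \<open>Since \<open>3 * N + 1 = 4 ^ q = 2 ^ (2 * q)\<close>, \<open>N\<close> is odd and its
  first step lands on \<open>2 ^ (2 * q - 1)\<close>. The other \<open>2 * q - 1\<close> steps are
  halvings down to 1, by \<open>collatz_T_funpow_two_power\<close>.\<close>

lemma collatz_T_funpow_two_power: "(collatz_T ^^ k) (2 ^ k) = 1"
proof (induction k)
  case (Suc k)
  have "collatz_T (2 ^ Suc k) = 2 ^ k"
    by (simp add: collatz_T_def)
  with Suc show ?case
    by (simp only: funpow_Suc_right o_apply)
qed simp

theorem corollary3:
  fixes q N :: nat
  assumes "q > 0"
    and "N = (4 ^ q - 1) div 3"
  shows "reaches_in N 1 (2 * q)"
proof -
  \<comment> \<open>\<open>k\<close> counts the halvings left after the single odd step; it exists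
    because \<open>q > 0\<close>.\<close>
  obtain k where k: "2 * q = Suc k"
    using assms(1) by (cases "2 * q") auto
  have "3 * N + 1 = (4 :: nat) ^ q"
    using four_power_quotient_exact assms(2) by simp
  also have "(4 :: nat) ^ q = 2 ^ (2 * q)"
    by (simp add: power_mult)
  finally have N: "3 * N + 1 = 2 * 2 ^ k"
    by (simp add: k)
  \<comment> \<open>\<open>3 * N + 1\<close> is even, so \<open>3 * N\<close> is odd.\<close>
  then have "odd N"
    by presburger
  with N have "collatz_T N = 2 ^ k"
    by (simp add: collatz_T_def)
  then show ?thesis
    using collatz_T_funpow_two_power[of k]
    by (simp only: reaches_in_def k funpow_Suc_right o_apply)
qed

end
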